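(* Let $d\ge1$, $b_1,\dots,b_d>0$, let $\Theta\subseteq\mathbb{R}^d$ be arbitrary, and let the source model $\mathcal{U}$ have densities on $\mathbb{X}=\mathbb{R}^d$ $$u(x;\theta)=\prod_{j=1}^d\frac{1}{2b_j}\exp\Big\{-\frac{|x_j-\theta_j|}{b_j}\Big\}.$$ Let the target model $\mathcal{V}$ have densities $v(y;\theta)$ on $\mathbb{Y}$, with $v(y;\theta)$ defined for all $\theta\in\mathbb{R}^d$ and such that the derivatives below exist. For $1\le k\le d$, $y\in\mathbb{Y}$, $x\in\mathbb{R}^d$ let $$v_k(y;x)=\Big(\big(I-b_{k+1}^2\nabla^{(2)}_{\theta_{k+1}}\big)\circ\cdots\circ\big(I-b_d^2\nabla^{(2)}_{\theta_d}\big)\,v(y;\theta)\Big)\Big|_{\theta=x},\qquad v_d(y;x)=v(y;\theta)\big|_{\theta=x}.$$ Assume that for each $1\le k\le d$, $y\in\mathbb{Y}$ and $x\in\mathbb{R}^d$ (the limits being pointwise, in the coordinate $x_k$ with the other coordinates of $x$ fixed), $$\lim_{x_k\to-\infty}e^{x_k/b_k}v_k(y;x)=0,\quad \lim_{x_k\to-\infty}e^{x_k/b_k}\frac{\partial v_k(y;x)}{\partial x_k}=0,\quad \lim_{x_k\to+\infty}e^{-x_k/b_k}v_k(y;x)=0,\quad \lim_{x_k\to+\infty}e^{-x_k/b_k}\frac{\partial v_k(y;x)}{\partial x_k}=0.$$ Then the signed kernel $$\mathcal{S}^*(y|x)=\Big(\big(I-b_1^2\nabla^{(2)}_{\theta_1}\big)\circ\cdots\circ\big(I-b_d^2\nabla^{(2)}_{\theta_d}\big)\,v(y;\theta)\Big)\Big|_{\theta=x}$$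 attains $\varsigma(\mathcal{U},\mathcal{V};\mathcal{S}^* )=0$.
   Context: $\nabla^{(2)}_{\theta_j}$ is the second partial derivative with respect to the coordinate $\theta_j$ and $I$ the identity operator; $\circ$ is composition of operators. $\mathbb{Y}$ is a measurable subset of a Euclidean space and densities are with respect to Lebesgue measure. A signed kernel with density $\mathcal{S}(y|x)$ assigns to each $x\in\mathbb{X}$ the signed measure $\mathcal{S}(y|x)\,\mathrm{d}y$ on $\mathbb{Y}$. The signed deficiency is $$\varsigma(\mathcal{U},\mathcal{V};\mathcal{S})=\sup_{\theta\in\Theta}\frac12\int_{\mathbb{Y}}\Big|v(y;\theta)-\int_{\mathbb{X}}\mathcal{S}(y|x)\,u(x;\theta)\,\mathrm{d}x\Big|\,\mathrm{d}y.$$ It is implicit that the target is twice differentiable in each coordinate $\theta_j$, so that the expression defining $\mathcal{S}^*$ is well-defined.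
   Formalization: It is additionally assumed that, for each θ in Θ and almost every y in Y, the function x ↦ S*(y|x)u(x;θ) is Lebesgue integrable on R^d, so that the integral in the signed deficiency is defined; the stated conditions do not imply this. *)

theory Defs
  imports "HOL-Analysis.Analysis"
begin

text \<open>
  Coordinates are indexed by a finite linearly ordered type in place of
  \<open>1 < \<dots> < d\<close>, because the order of the coordinate operators matters below.
\<close>

definition upd :: "real ^ 'd \<Rightarrow> 'd \<Rightarrow> real \<Rightarrow> real ^ 'd" where
  "upd x j t = (\<chi> i. if i = j then t else x $ i)"

definition partial_deriv :: "'d \<Rightarrow> (real ^ 'd \<Rightarrow> real) \<Rightarrow> real ^ 'd \<Rightarrow> real" where
  "partial_deriv j f x = deriv (\<lambda>t. f (upd x j t)) (x $ j)"

definition coord_differentiable :: "'d \<Rightarrow> (real ^ 'd \<Rightarrow> real) \<Rightarrow> bool" where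
  "coord_differentiable j f \<longleftrightarrow>
     (\<forall>x. (\<lambda>t. f (upd x j t)) differentiable (at (x $ j)))"

definition twice_coord_differentiable :: "'d \<Rightarrow> (real ^ 'd \<Rightarrow> real) \<Rightarrow> bool" where
  "twice_coord_differentiable j f \<longleftrightarrow>
     coord_differentiable j f \<and> coord_differentiable j (partial_deriv j f)"

definition coord_op :: "real ^ 'd \<Rightarrow> 'd \<Rightarrow> (real ^ 'd \<Rightarrow> real) \<Rightarrow> real ^ 'd \<Rightarrow> real" where
  "coord_op b j f = (\<lambda>x. f x - (b $ j)\<^sup>2 * partial_deriv j (partial_deriv j f) x)"

text \<open>The operator of the least index in \<open>A\<close> is outermost, that is, applied last.\<close>

definition
  "coord_ops b A f = foldr (coord_op b) (sorted_list_of_set A) f"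

definition
  "v_part b v k y = coord_ops b {k<..} (v y)"

definition
  "S_star b v y = coord_ops b UNIV (v y)"

definition laplace_density :: "real ^ 'd \<Rightarrow> real ^ 'd \<Rightarrow> real ^ 'd \<Rightarrow> real" where
  "laplace_density b x \<theta> =
     (\<Prod>j\<in>UNIV. 1 / (2 * b $ j) * exp (- (\<bar>x $ j - \<theta> $ j\<bar> / b $ j)))"

definition density_family :: "'y measure \<Rightarrow> 'p set \<Rightarrow> ('y \<Rightarrow> 'p \<Rightarrow> real) \<Rightarrow> bool" where
  "density_family M \<Theta> p \<longleftrightarrow>
     (\<forall>\<theta>\<in>\<Theta>. (\<lambda>y. p y \<theta>) \<in> borel_measurable M \<and> (\<forall>y\<in>space M. 0 \<le> p y \<theta>) \<and>
            (\<integral>\<^sup>+ y. ennreal (p y \<theta>) \<partial>M) = 1)"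

text \<open>
  The supremum over an empty parameter set is 0. The inner Bochner integral is 0 where
  the integrand is not integrable, so the value is meaningful only if
  \<open>x \<mapsto> S y x * u x \<theta>\<close> is integrable for every \<open>\<theta> \<in> \<Theta>\<close> and almost every \<open>y\<close>.
\<close>

definition signed_deficiency ::
  "'x measure \<Rightarrow> 'y measure \<Rightarrow> 'p set \<Rightarrow> ('x \<Rightarrow> 'p \<Rightarrow> real) \<Rightarrow> ('y \<Rightarrow> 'p \<Rightarrow> real) \<Rightarrow>
   ('y \<Rightarrow> 'x \<Rightarrow> real) \<Rightarrow> ennreal" where
  "signed_deficiency MX MY \<Theta> u v S =
     (SUP \<theta>\<in>\<Theta>. ennreal (1 / 2) *
        (\<integral>\<^sup>+ y. ennreal \<bar>v y \<theta> - (\<integral> x. S y x * u x \<theta> \<partial>MX)\<bar> \<partial>MY))"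

end

theory Submission
  imports Defs
begin

section \<open>The one-dimensional Laplace identity\<close>

definition laplace_kernel :: "real \<Rightarrow> real \<Rightarrow> real \<Rightarrow> real" where
  "laplace_kernel b \<theta> t = 1 / (2 * b) * exp (- (\<bar>t - \<theta>\<bar> / b))"

lemma laplace_kernel_pos: "0 < b \<Longrightarrow> 0 < laplace_kernel b \<theta> t"
  by (simp add: laplace_kernel_def)

lemma laplace_density_eq_prod:
  "laplace_density b x \<theta> = (\<Prod>j\<in>UNIV. laplace_kernel (b $ j) (\<theta> $ j) (x $ j))"
  by (simp add: laplace_density_def laplace_kernel_def)

text \<open>The gauge integral integrates every derivative, continuous or not, and ignores changes
  on negligible sets, so \<open>h\<close> may replace \<open>f\<close> under it. Since
  \<open>h\<close> is Lebesgue integrable, its gauge and Lebesgue integrals agree.\<close>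

lemma integral_eq_by_FTC:
  fixes F f h :: "real \<Rightarrow> real"
  assumes "u \<le> w"
    and deriv: "\<And>t. (F has_real_derivative f t) (at t)"
    and h: "integrable lborel h"
    and ae: "AE t in lborel. t \<in> {u..w} \<longrightarrow> h t = f t"
  shows "(LINT t:{u..w}|lborel. h t) = F w - F u"
proof -
  have "(f has_integral F w - F u) {u..w}"
    using \<open>u \<le> w\<close> deriv
    by (intro fundamental_theorem_of_calculus)
       (auto simp: has_real_derivative_iff_has_vector_derivative[symmetric]
             intro: has_field_derivative_at_within)
  moreover obtain N where N: "N \<in> null_sets lborel" "{t. \<not> (t \<in> {u..w} \<longrightarrow> h t = f t)} \<subseteq> N"
    using ae by (auto elim: AE_E simp: null_sets_def)
  moreover have "negligible N"
    using N(1) by (simp add: negligible_iff_null_sets null_sets_completionI)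
  ultimately have "(h has_integral F w - F u) {u..w}"
    by (elim has_integral_spike[rotated 2]) auto
  moreover have "set_integrable lborel {u..w} h"
    unfolding set_integrable_def using integrable_mult_indicator[OF _ h, of "{u..w}"] by simp
  ultimately show ?thesis
    by (simp add: set_borel_integral_eq_integral integral_unique)
qed

text \<open>
  The function \<open>e\<^sup>-\<^sup>s\<^sup>t (f + s\<inverse> f')\<close> with \<open>s = \<plusminus> 1 / b\<close> is an antiderivative of
  \<open>\<mp> b\<inverse> e\<^sup>-\<^sup>s\<^sup>t (f - b\<^sup>2 f'')\<close>. As \<open>f''\<close> need not be continuous, the fundamental theorem
  of calculus is used for the gauge integral.
\<close>

lemma laplace_integral_1d:
  fixes f f' f'' h :: "real \<Rightarrow> real"
  assumes b: "0 < b"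
    and f: "\<And>t. (f has_real_derivative f' t) (at t)"
    and f': "\<And>t. (f' has_real_derivative f'' t) (at t)"
    and bot: "((\<lambda>t. exp (t / b) * f t) \<longlongrightarrow> 0) at_bot"
    and bot': "((\<lambda>t. exp (t / b) * f' t) \<longlongrightarrow> 0) at_bot"
    and top: "((\<lambda>t. exp (- (t / b)) * f t) \<longlongrightarrow> 0) at_top"
    and top': "((\<lambda>t. exp (- (t / b)) * f' t) \<longlongrightarrow> 0) at_top"
    and h: "integrable lborel h"
    and ae: "AE t in lborel. h t = (f t - b\<^sup>2 * f'' t) * laplace_kernel b \<theta> t"
  shows "integral\<^sup>L lborel h = f \<theta>"
proof -
  \<comment> \<open>On each side of \<theta> the absolute value in the kernel resolves to one sign:
    \<open>R\<close> serves the right side and \<open>L\<close> the left. The factors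
    \<open>exp (\<theta> / b) / 2\<close> and \<open>exp (- (\<theta> / b)) / 2\<close> restore the
    kernel's shift and normalisation. The exponentials stay grouped with \<open>f\<close> and
    \<open>f'\<close> to match the limit hypotheses.\<close>
  define R where "R t = - exp (\<theta> / b) / 2 * (exp (- (t / b)) * f t + b * (exp (- (t / b)) * f' t))" for t
  define L where "L t = exp (- (\<theta> / b)) / 2 * (exp (t / b) * f t - b * (exp (t / b) * f' t))" for t
  have set_int: "set_integrable lborel A h" if "A \<in> sets lborel" for A
    unfolding set_integrable_def using integrable_mult_indicator[OF that h] by simp
  have R: "(R has_real_derivative (f t - b\<^sup>2 * f'' t) * (exp (\<theta> / b) * exp (- (t / b)) / (2 * b))) (at t)" for t
    unfolding R_def using b
    by (auto intro!: derivative_eq_intros f f' simp: field_simps power2_eq_square)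
  have L: "(L has_real_derivative (f t - b\<^sup>2 * f'' t) * (exp (- (\<theta> / b)) * exp (t / b) / (2 * b))) (at t)" for t
    unfolding L_def using b
    by (auto intro!: derivative_eq_intros f f' simp: field_simps power2_eq_square)
  have right: "(LINT t:{\<theta>..w}|lborel. h t) = R w - R \<theta>" if "\<theta> \<le> w" for w
  proof (rule integral_eq_by_FTC[OF that R h])
    show "AE t in lborel. t \<in> {\<theta>..w} \<longrightarrow>
        h t = (f t - b\<^sup>2 * f'' t) * (exp (\<theta> / b) * exp (- (t / b)) / (2 * b))"
      using ae by eventually_elim
        (auto simp: laplace_kernel_def diff_divide_distrib simp flip: exp_add)
  qed
  have left: "(LINT t:{u..\<theta>}|lborel. h t) = L \<theta> - L u" if "u \<le> \<theta>" for u
  proof (rule integral_eq_by_FTC[OF that L h])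
    show "AE t in lborel. t \<in> {u..\<theta>} \<longrightarrow>
        h t = (f t - b\<^sup>2 * f'' t) * (exp (- (\<theta> / b)) * exp (t / b) / (2 * b))"
      using ae by eventually_elim
        (auto simp: laplace_kernel_def diff_divide_distrib simp flip: exp_add)
  qed
  have "(R \<longlongrightarrow> - exp (\<theta> / b) / 2 * (0 + b * 0)) at_top"
    unfolding R_def by (intro tendsto_intros top top')
  then have "((\<lambda>w. R w - R \<theta>) \<longlongrightarrow> - R \<theta>) at_top"
    by (auto intro!: tendsto_eq_intros)
  \<comment> \<open>The truncated integral is \<open>R w - R \<theta>\<close> only for
    \<open>w \<ge> \<theta>\<close>, which is enough at infinity. By uniqueness of limits, the
    integral over the half-line is then \<open>- R \<theta>\<close>; the left side is treated in the
    same way.\<close>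
  moreover have "((\<lambda>w. LINT t:{\<theta>..w}|lborel. h t) \<longlongrightarrow> (LINT t:{\<theta>..}|lborel. h t)) at_top"
    by (intro tendsto_set_lebesgue_integral_at_top set_int) auto
  then have "((\<lambda>w. R w - R \<theta>) \<longlongrightarrow> (LINT t:{\<theta>..}|lborel. h t)) at_top"
    by (rule Lim_transform_eventually) (rule eventually_mono[OF eventually_ge_at_top[of \<theta>] right])
  ultimately have int_right: "(LINT t:{\<theta>..}|lborel. h t) = - R \<theta>"
    using tendsto_unique[OF trivial_limit_at_top_linorder] by blast
  have "(L \<longlongrightarrow> exp (- (\<theta> / b)) / 2 * (0 - b * 0)) at_bot"
    unfolding L_def by (intro tendsto_intros bot bot')
  then have "((\<lambda>u. L \<theta> - L u) \<longlongrightarrow> L \<theta>) at_bot"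
    by (auto intro!: tendsto_eq_intros)
  moreover have "((\<lambda>u. LINT t:{u..\<theta>}|lborel. h t) \<longlongrightarrow> (LINT t:{..\<theta>}|lborel. h t)) at_bot"
    by (intro tendsto_set_lebesgue_integral_at_bot set_int) auto
  then have "((\<lambda>u. L \<theta> - L u) \<longlongrightarrow> (LINT t:{..\<theta>}|lborel. h t)) at_bot"
    by (rule Lim_transform_eventually) (rule eventually_mono[OF eventually_le_at_bot[of \<theta>] left])
  ultimately have int_left: "(LINT t:{..\<theta>}|lborel. h t) = L \<theta>"
    using tendsto_unique[OF trivial_limit_at_bot_linorder] by blast
  have UNIV: "{..\<theta>} \<union> {\<theta>..} = UNIV" by auto
  have "integral\<^sup>L lborel h = (LINT t:{..\<theta>} \<union> {\<theta>..}|lborel. h t)"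
    unfolding UNIV by (simp add: set_lebesgue_integral_def)
  also have "\<dots> = (LINT t:{..\<theta>}|lborel. h t) + (LINT t:{\<theta>..}|lborel. h t)"
  proof (intro set_integral_Un_AE set_int)
    show "AE t in lborel. \<not> (t \<in> {..\<theta>} \<and> t \<in> {\<theta>..})"
      using AE_lborel_singleton[of \<theta>] by eventually_elim auto
  qed auto
  \<comment> \<open>The two half-lines contribute \<open>(f \<theta> - b * f' \<theta>) / 2\<close>
    and \<open>(f \<theta> + b * f' \<theta>) / 2\<close>, so the derivative terms cancel.\<close>
  also have "\<dots> = f \<theta>"
  proof -
    have "R \<theta> = - (exp (\<theta> / b) * exp (- (\<theta> / b))) * (f \<theta> + b * f' \<theta>) / 2"
      "L \<theta> = (exp (\<theta> / b) * exp (- (\<theta> / b))) * (f \<theta> - b * f' \<theta>) / 2"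
      by (simp_all add: R_def L_def algebra_simps)
    moreover have "exp (\<theta> / b) * exp (- (\<theta> / b)) = 1"
      by (simp flip: exp_add)
    ultimately show ?thesis
      by (simp add: int_right int_left algebra_simps)
  qed
  finally show ?thesis .
qed

section \<open>Splitting one coordinate off a finite product measure\<close>

text \<open>Tonelli evaluates both measures of a set as the same iterated integral. The identity
  carries integrability and almost-everywhere facts from the larger product to a binary
  product.\<close>

lemma (in product_sigma_finite) distr_fun_upd:
  assumes I: "finite I" "i \<notin> I"
  shows "distr (Pi\<^sub>M I M \<Otimes>\<^sub>M M i) (Pi\<^sub>M (insert i I) M) (\<lambda>(x, y). x(i := y)) = Pi\<^sub>M (insert i I) M"
    (is "?D = ?P")
proof (rule measure_eqI)
  interpret I: finite_product_sigma_finite M I by standard fact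
  interpret P: pair_sigma_finite "Pi\<^sub>M I M" "M i" ..
  fix A assume "A \<in> sets ?D"
  then have A[measurable]: "A \<in> sets ?P" by simp
  have "emeasure ?D A = (\<integral>\<^sup>+ z. indicator A ((\<lambda>(x, y). x(i := y)) z) \<partial>(Pi\<^sub>M I M \<Otimes>\<^sub>M M i))"
    by (subst nn_integral_distr[OF measurable_add_dim, symmetric]) auto
  also have "\<dots> = (\<integral>\<^sup>+ x. \<integral>\<^sup>+ y. indicator A (x(i := y)) \<partial>M i \<partial>Pi\<^sub>M I M)"
    by (subst M.nn_integral_fst[symmetric])
       (auto intro!: measurable_compose[OF measurable_add_dim])
  also have "\<dots> = emeasure ?P A"
    using I by (simp add: product_nn_integral_insert[symmetric])
  finally show "emeasure ?D A = emeasure ?P A" .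
qed simp

text \<open>After transport along \<open>distr_fun_upd\<close>, both claims are Fubini's theorem for
  the binary product.\<close>

lemma (in product_sigma_finite)
  fixes f :: "_ \<Rightarrow> _::{banach, second_countable_topology}"
  assumes I: "finite I" "i \<notin> I"
    and f: "integrable (Pi\<^sub>M (insert i I) M) f"
  shows AE_product_integrable_insert: "AE x in Pi\<^sub>M I M. integrable (M i) (\<lambda>y. f (x(i := y)))"
    and product_integrable_insert: "integrable (Pi\<^sub>M I M) (\<lambda>x. \<integral>y. f (x(i := y)) \<partial>M i)"
proof -
  interpret I: finite_product_sigma_finite M I by standard fact
  interpret P: pair_sigma_finite "Pi\<^sub>M I M" "M i" ..
  have "integrable (Pi\<^sub>M I M \<Otimes>\<^sub>M M i) (\<lambda>z. f ((\<lambda>(x, y). x(i := y)) z))"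
    by (rule integrable_distr[OF measurable_add_dim]) (simp add: distr_fun_upd I f)
  from P.AE_integrable_fst'[OF this] P.integrable_fst'[OF this]
  show "AE x in Pi\<^sub>M I M. integrable (M i) (\<lambda>y. f (x(i := y)))"
    and "integrable (Pi\<^sub>M I M) (\<lambda>x. \<integral>y. f (x(i := y)) \<partial>M i)"
    by simp_all
qed

lemma (in product_sigma_finite) AE_product_insert:
  assumes I: "finite I" "i \<notin> I"
    and P: "AE x in Pi\<^sub>M (insert i I) M. P x"
  shows "AE x in Pi\<^sub>M I M. AE y in M i. P (x(i := y))"
proof -
  interpret I: finite_product_sigma_finite M I by standard fact
  interpret P: pair_sigma_finite "Pi\<^sub>M I M" "M i" ..
  have "AE z in Pi\<^sub>M I M \<Otimes>\<^sub>M M i. P ((\<lambda>(x, y). x(i := y)) z)"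
    by (rule AE_distrD[OF measurable_add_dim], subst distr_fun_upd) (fact I P)+
  from P.AE_pair[OF this] show ?thesis by simp
qed

section \<open>Lebesgue measure on vectors as a product measure\<close>

lemma measurable_vec_lambda_PiM_lborel:
  "(\<lambda>x. \<chi> i. x i) \<in> measurable (Pi\<^sub>M UNIV (\<lambda>_::'d::finite. lborel :: real measure)) borel"
proof (subst borel_measurable_euclidean_space, intro ballI)
  fix e :: "real ^ 'd" assume "e \<in> Basis"
  then obtain i where e: "e = axis i 1" by (auto simp: Basis_vec_def)
  have "(\<lambda>x. x i) \<in> measurable (Pi\<^sub>M UNIV (\<lambda>_::'d. lborel :: real measure)) lborel"
    by (rule measurable_component_singleton) simp
  then show "(\<lambda>x. (\<chi> i. x i) \<bullet> e) \<in> borel_measurable (Pi\<^sub>M UNIV (\<lambda>_::'d. lborel :: real measure))"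
    by (simp add: e inner_axis)
qed

text \<open>Lebesgue measure is determined by its values on boxes. The preimage of a box is a
  product of intervals, whose product measure is the product of the side lengths.\<close>

lemma lborel_eq_distr_PiM:
  "(lborel :: (real ^ 'd::finite) measure) =
     distr (Pi\<^sub>M UNIV (\<lambda>_::'d. lborel)) borel (\<lambda>x. \<chi> i. x i)"
proof (rule lborel_eqI)
  interpret product_sigma_finite "\<lambda>_::'d. lborel :: real measure" ..
  fix l u :: "real ^ 'd"
  assume lu: "\<And>e. e \<in> Basis \<Longrightarrow> l \<bullet> e \<le> u \<bullet> e"
  have le: "l $ i \<le> u $ i" for i
    using lu[of "axis i 1"] by (auto simp: inner_axis)
  have "(\<lambda>x. \<chi> i. x i) -` box l u \<inter> space (Pi\<^sub>M UNIV (\<lambda>_::'d. lborel)) =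
      Pi\<^sub>E UNIV (\<lambda>i. box (l $ i) (u $ i))"
    by (auto simp: mem_box_cart space_PiM PiE_def Pi_def)
  then have "emeasure (distr (Pi\<^sub>M UNIV (\<lambda>_::'d. lborel)) borel (\<lambda>x. \<chi> i. x i)) (box l u) =
      (\<Prod>i\<in>UNIV. emeasure lborel (box (l $ i) (u $ i)))"
    by (simp add: emeasure_distr measurable_vec_lambda_PiM_lborel emeasure_PiM)
  also have "\<dots> = (\<Prod>i\<in>UNIV. ennreal (u $ i - l $ i))"
    using le by (intro prod.cong) auto
  also have "\<dots> = ennreal (\<Prod>i\<in>UNIV. (u - l) $ i)"
    using le by (subst prod_ennreal) auto
  also have "(\<Prod>i\<in>UNIV. (u - l) $ i) = (\<Prod>e\<in>Basis. (u - l) \<bullet> e)"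
  proof -
    have Basis: "(Basis :: (real ^ 'd) set) = (\<lambda>i. axis i 1) ` UNIV"
      by (auto simp: Basis_vec_def)
    have "inj (\<lambda>i::'d. axis i (1::real))"
      by (auto simp: inj_def axis_eq_axis)
    then show ?thesis
      unfolding Basis by (simp add: prod.reindex inner_axis)
  qed
  finally show "emeasure (distr (Pi\<^sub>M UNIV (\<lambda>_::'d. lborel)) borel (\<lambda>x. \<chi> i. x i)) (box l u) =
      ennreal (\<Prod>e\<in>Basis. (u - l) \<bullet> e)" .
qed simp

section \<open>Coordinate derivatives and operators\<close>

lemma upd_upd [simp]: "upd (upd x k s) k t = upd x k t"
  by (simp add: upd_def vec_eq_iff)

lemma upd_nth [simp]: "upd x k t $ k = t"
  by (simp add: upd_def)

text \<open>\<open>coord_differentiable\<close> speaks only of the derivative at a point's own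
  coordinate. Applying it at the point \<open>upd x k t\<close> covers the whole line through
  \<open>x\<close>, because a second update overwrites the first.\<close>

lemma has_derivative_upd:
  assumes "coord_differentiable k g"
  shows "((\<lambda>t. g (upd x k t)) has_real_derivative partial_deriv k g (upd x k t)) (at t)"
proof -
  have "(\<lambda>s. g (upd (upd x k t) k s)) differentiable (at (upd x k t $ k))"
    using assms unfolding coord_differentiable_def by blast
  then show ?thesis
    by (simp add: partial_deriv_def DERIV_deriv_iff_real_differentiable)
qed

lemma coord_ops_empty [simp]: "coord_ops b {} f = f"
  by (simp add: coord_ops_def)

text \<open>An index below all of \<open>A\<close> becomes the head of the sorted list, and
  \<open>foldr\<close> applies the head last.\<close>

lemma coord_ops_insert_less:
  assumes "finite A" "\<forall>a\<in>A. k < a"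
  shows "coord_ops b (insert k A) f = coord_op b k (coord_ops b A f)"
proof -
  have "k \<notin> A" using assms by auto
  moreover have "insort k (sorted_list_of_set A) = k # sorted_list_of_set A"
    using assms by (intro insort_is_Cons) (auto simp: less_imp_le)
  ultimately show ?thesis
    using assms by (simp add: coord_ops_def)
qed

section \<open>Integrating out the coordinates, least index first\<close>

text \<open>Coordinates in \<open>A\<close> are still to be integrated. The others have been
  integrated out already, each integration having evaluated the function at the corresponding
  coordinate of \<theta>.\<close>

definition fill :: "'d set \<Rightarrow> real ^ 'd \<Rightarrow> ('d \<Rightarrow> real) \<Rightarrow> real ^ 'd" where
  "fill A \<theta> x = (\<chi> i. if i \<in> A then x i else \<theta> $ i)"

lemma fill_insert:
  "k \<notin> A \<Longrightarrow> fill (insert k A) \<theta> (x(k := t)) = upd (fill A \<theta> x) k t"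
  by (auto simp: fill_def upd_def vec_eq_iff)

text \<open>
  Integrating out the least coordinate with the one-dimensional formula undoes the outermost
  operator. The integrand is a separate \<open>h\<close>, known only almost everywhere: the hypotheses do not
  make \<open>coord_ops b A g\<close> measurable, whereas Fubini's theorem gives an integrable function that
  agrees almost everywhere with it times the remaining density.
\<close>

lemma laplace_integral_upper_set:
  fixes b \<theta> :: "real ^ 'd::{finite,linorder}" and g :: "real ^ 'd::{finite,linorder} \<Rightarrow> real"
  assumes b_pos: "\<And>j. 0 < b $ j"
    and diff: "\<And>k. twice_coord_differentiable k (coord_ops b {k<..} g)"
    and bot: "\<And>k x. ((\<lambda>t. exp (t / b $ k) * coord_ops b {k<..} g (upd x k t)) \<longlongrightarrow> 0) at_bot"
    and bot': "\<And>k x. ((\<lambda>t. exp (t / b $ k) * partial_deriv k (coord_ops b {k<..} g) (upd x k t)) \<longlongrightarrow> 0) at_bot"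
    and top: "\<And>k x. ((\<lambda>t. exp (- (t / b $ k)) * coord_ops b {k<..} g (upd x k t)) \<longlongrightarrow> 0) at_top"
    and top': "\<And>k x. ((\<lambda>t. exp (- (t / b $ k)) * partial_deriv k (coord_ops b {k<..} g) (upd x k t)) \<longlongrightarrow> 0) at_top"
    and upper: "\<And>i j. i \<in> A \<Longrightarrow> i < j \<Longrightarrow> j \<in> A"
    and h: "integrable (Pi\<^sub>M A (\<lambda>_. lborel)) h"
    and ae: "AE x in Pi\<^sub>M A (\<lambda>_. lborel).
      h x = coord_ops b A g (fill A \<theta> x) * (\<Prod>j\<in>A. laplace_kernel (b $ j) (\<theta> $ j) (x j))"
  shows "integral\<^sup>L (Pi\<^sub>M A (\<lambda>_. lborel)) h = g \<theta>"
proof -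
  interpret product_sigma_finite "\<lambda>_::'d. lborel :: real measure" ..
  have "finite A" by simp
  then show ?thesis
    using upper h ae
  proof (induction A arbitrary: h rule: finite_linorder_min_induct)
    case empty
    have "fill {} \<theta> x = \<theta>" for x by (simp add: fill_def vec_eq_iff)
    \<comment> \<open>The empty product is counting measure on the single point
      \<open>\<lambda>_. undefined\<close>, so the almost-everywhere equation holds at that
      point.\<close>
    with empty.prems(3) have "h (\<lambda>_. undefined) = g \<theta>"
      unfolding PiM_empty AE_count_space by simp
    then show ?case
      by (simp add: PiM_empty lebesgue_integral_count_space_finite)
  next
    case (insert k A)
    have k: "k \<notin> A" using insert.hyps by auto
    \<comment> \<open>An upward closed set with minimum \<open>k\<close> contains every larger
      index, so the assumptions on \<open>coord_ops b {k<..} g\<close> concern exactly the function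
      left after removing the operator of \<open>k\<close>.\<close>
    have A: "A = {k<..}"
      using insert.hyps(2) insert.prems(1)[of k] by force
    let ?c = "\<lambda>x. \<Prod>j\<in>A. laplace_kernel (b $ j) (\<theta> $ j) (x j)"
    let ?G = "coord_ops b A g"
    \<comment> \<open>This partial integral takes the place of \<open>h\<close> in the induction
      hypothesis for \<open>A\<close>.\<close>
    define h' where "h' x = (\<integral>t. h (x(k := t)) \<partial>lborel)" for x
    have "AE x in Pi\<^sub>M A (\<lambda>_. lborel). AE t in lborel.
        h (x(k := t)) = coord_ops b (insert k A) g (fill (insert k A) \<theta> (x(k := t))) *
          (\<Prod>j\<in>insert k A. laplace_kernel (b $ j) (\<theta> $ j) ((x(k := t)) j))"
      by (rule AE_product_insert[OF insert.hyps(1) k insert.prems(3)])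
    moreover have "AE x in Pi\<^sub>M A (\<lambda>_. lborel). integrable lborel (\<lambda>t. h (x(k := t)))"
      by (rule AE_product_integrable_insert[OF insert.hyps(1) k insert.prems(2)])
    ultimately have "AE x in Pi\<^sub>M A (\<lambda>_. lborel). h' x = ?G (fill A \<theta> x) * ?c x"
    proof eventually_elim
      case (elim x)
      let ?x = "fill A \<theta> x"
      \<comment> \<open>For fixed \<open>x\<close> the kernels of the remaining coordinates form a
        nonzero constant in \<open>t\<close>; dividing by it leaves the integrand of the
        one-dimensional formula.\<close>
      have c: "?c x > 0" by (intro prod_pos ballI laplace_kernel_pos b_pos)
      have diffs: "coord_differentiable k ?G" "coord_differentiable k (partial_deriv k ?G)"
        using diff[of k] by (auto simp: twice_coord_differentiable_def A)
      have "integral\<^sup>L lborel (\<lambda>t. h (x(k := t)) / ?c x) = ?G (upd ?x k (\<theta> $ k))"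
      proof (rule laplace_integral_1d[OF b_pos[of k] has_derivative_upd[OF diffs(1)] has_derivative_upd[OF diffs(2)]])
        show "integrable lborel (\<lambda>t. h (x(k := t)) / ?c x)"
          using elim(2) by simp
        have prod_eq: "(\<Prod>j\<in>A. laplace_kernel (b $ j) (\<theta> $ j) ((x(k := t)) j)) = ?c x" for t
          using k by (intro prod.cong) auto
        show "AE t in lborel. h (x(k := t)) / ?c x =
            (?G (upd ?x k t) - (b $ k)\<^sup>2 * partial_deriv k (partial_deriv k ?G) (upd ?x k t)) *
              laplace_kernel (b $ k) (\<theta> $ k) t"
          using elim(1)
        proof eventually_elim
          case (elim t)
          then show ?case
            using less_imp_neq[OF c] k insert.hyps prod_eq
            by (simp del: prod_zero_iff fun_upd_apply
                add: fun_upd_same coord_ops_insert_less fill_insert coord_op_def)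
        qed
      qed (use bot[of k] bot'[of k] top[of k] top'[of k] in \<open>simp_all add: A\<close>)
      \<comment> \<open>Evaluation at \<open>\<theta> $ k\<close> changes nothing, since
        \<open>fill\<close> already has that value outside \<open>A\<close>.\<close>
      moreover have "upd ?x k (\<theta> $ k) = ?x"
        using k by (auto simp: upd_def fill_def vec_eq_iff)
      ultimately show ?case
        using less_imp_neq[OF c] by (simp del: prod_zero_iff add: h'_def divide_eq_eq)
    qed
    moreover have "integrable (Pi\<^sub>M A (\<lambda>_. lborel)) h'"
      unfolding h'_def by (rule product_integrable_insert[OF insert.hyps(1) k insert.prems(2)])
    moreover have "j \<in> A" if "i \<in> A" "i < j" for i j
      using that A by auto
    ultimately have "integral\<^sup>L (Pi\<^sub>M A (\<lambda>_. lborel)) h' = g \<theta>"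
      by (intro insert.IH) auto
    then show ?case
      using product_integral_insert[OF insert.hyps(1) k insert.prems(2)]
      by (simp del: fun_upd_apply add: h'_def[abs_def])
  qed
qed

section \<open>Vanishing of the deficiency\<close>

theorem proposition2:
  fixes b :: "real ^ 'd::{finite,linorder}"
    and \<Theta> :: "(real ^ 'd::{finite,linorder}) set"
    and Y :: "'y::euclidean_space set"
    and v :: "'y \<Rightarrow> real ^ 'd::{finite,linorder} \<Rightarrow> real"
  assumes b_pos: "\<And>j. 0 < b $ j"
    and Y_meas: "Y \<in> sets lebesgue"
    and target: "density_family (lebesgue_on Y) \<Theta> v"
    and derivs_exist: "\<And>k y. y \<in> Y \<Longrightarrow> twice_coord_differentiable k (v_part b v k y)"
    and lim_bot: "\<And>k y x. y \<in> Y \<Longrightarrow>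
          ((\<lambda>t. exp (t / b $ k) * v_part b v k y (upd x k t)) \<longlongrightarrow> 0) at_bot"
    and lim_bot_deriv: "\<And>k y x. y \<in> Y \<Longrightarrow>
          ((\<lambda>t. exp (t / b $ k) * partial_deriv k (v_part b v k y) (upd x k t)) \<longlongrightarrow> 0) at_bot"
    and lim_top: "\<And>k y x. y \<in> Y \<Longrightarrow>
          ((\<lambda>t. exp (- (t / b $ k)) * v_part b v k y (upd x k t)) \<longlongrightarrow> 0) at_top"
    and lim_top_deriv: "\<And>k y x. y \<in> Y \<Longrightarrow>
          ((\<lambda>t. exp (- (t / b $ k)) * partial_deriv k (v_part b v k y) (upd x k t)) \<longlongrightarrow> 0) at_top"
    and deficiency_well_defined: "\<And>\<theta>. \<theta> \<in> \<Theta> \<Longrightarrow>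
          AE y in lebesgue_on Y. integrable lborel (\<lambda>x. S_star b v y x * laplace_density b x \<theta>)"
  shows "signed_deficiency lborel (lebesgue_on Y) \<Theta> (laplace_density b) v (S_star b v) = 0"
proof -
  \<comment> \<open>The full index set is trivially upward closed, so the preceding lemma with
    \<open>A = UNIV\<close> recovers the target density at every \<open>y\<close> where the inner
    integrand is integrable.\<close>
  have integral_eq: "(\<integral>x. S_star b v y x * laplace_density b x \<theta> \<partial>lborel) = v y \<theta>"
    if y: "y \<in> Y" and int: "integrable lborel (\<lambda>x. S_star b v y x * laplace_density b x \<theta>)" for y \<theta>
  proof -
    let ?P = "Pi\<^sub>M UNIV (\<lambda>_::'d. lborel :: real measure)"
    let ?f = "\<lambda>x. S_star b v y x * laplace_density b x \<theta>"
    let ?h = "\<lambda>x. ?f (\<chi> i. x i)"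
    have meas: "(\<lambda>x. \<chi> i. x i) \<in> measurable ?P borel"
      by (rule measurable_vec_lambda_PiM_lborel)
    have int_h: "integrable ?P ?h"
      using int by (intro integrable_distr[OF meas]) (simp flip: lborel_eq_distr_PiM)
    have "integral\<^sup>L lborel ?f = integral\<^sup>L ?P ?h"
      using int by (subst lborel_eq_distr_PiM) (intro integral_distr[OF meas], auto)
    also have "\<dots> = v y \<theta>"
    proof (rule laplace_integral_upper_set[OF b_pos _ _ _ _ _ _ int_h])
      show "AE x in ?P. ?h x = coord_ops b UNIV (v y) (fill UNIV \<theta> x) *
          (\<Prod>j\<in>UNIV. laplace_kernel (b $ j) (\<theta> $ j) (x j))"
        by (simp add: S_star_def laplace_density_eq_prod fill_def)
    qed (use derivs_exist lim_bot lim_bot_deriv lim_top lim_top_deriv y in \<open>simp_all add: v_part_def\<close>)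
    finally show ?thesis .
  qed
  have "(\<integral>\<^sup>+ y. ennreal \<bar>v y \<theta> - (\<integral>x. S_star b v y x * laplace_density b x \<theta> \<partial>lborel)\<bar>
      \<partial>lebesgue_on Y) = 0" if \<theta>: "\<theta> \<in> \<Theta>" for \<theta>
  proof -
    \<comment> \<open>The remaining \<open>y\<close>, where the inner integral takes its default
      value 0, form a null set; \<open>AE_space\<close> supplies \<open>y \<in> Y\<close>.\<close>
    have "AE y in lebesgue_on Y.
        ennreal \<bar>v y \<theta> - (\<integral>x. S_star b v y x * laplace_density b x \<theta> \<partial>lborel)\<bar> = 0"
      using deficiency_well_defined[OF \<theta>] AE_space
      by eventually_elim (simp add: integral_eq)
    then show ?thesis
      by (subst nn_integral_cong_AE) auto
  qed
  then have "signed_deficiency lborel (lebesgue_on Y) \<Theta> (laplace_density b) v (S_star b v) =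
      (SUP \<theta>\<in>\<Theta>. 0)"
    unfolding signed_deficiency_def by (intro SUP_cong refl) simp
  \<comment> \<open>For empty \<Theta> the supremum is the bottom element of \<open>ennreal\<close>,
    which is also 0.\<close>
  also have "\<dots> = 0"
    by (simp add: SUP_constant bot_ennreal)
  finally show ?thesis .
qed

end
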